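(* Let $l\ge1$ and let $(\mathbb R^{2l},\omega_0,\nabla)$ be the standard symplectic vector space equipped with the standard flat Euclidean connection $\nabla$, regarded as a Fedosov manifold with its (unique up to isomorphism) trivial metaplectic structure. Then any symplectic Killing spinor number is zero and any symplectic Killing spinor field is constant, i.e., viewed as a map $\phi:\mathbb R^{2l}\to L^2(\mathbb R^l)$ by means of the canonical trivialization of the symplectic spinor bundle, it satisfies $\phi\equiv\overline\psi$ for some $\overline\psi\in L^2(\mathbb R^l)$.
   Context: Algebraic conventions. On $\mathbb V=\mathbb R^{2l}$ with coordinates $(s^1,\dots,s^l,t^1,\dots,t^l)$ let $e_i=\partial/\partial s^i$, $e_{l+i}=\partial/\partial t^i$ ($1\le i\le l$), and let $\omega_0$ be the standard symplectic form, $\omega_0(e_i,e_{l+i})=1=-\omega_0(e_{l+i},e_i)$, all other $\omega_0(e_i,e_j)=0$; $\mathbb L=\mathrm{span}(e_1,\dots,e_l)\simeq\mathbb R^l$. $G=Sp(\mathbb V,\omega_0)$, $\kappa:\tilde G\to G$ is the connected double cover (metaplectic group). ${\bf S}=L^2(\mathbb L)$ (complex valued); the symplectic Clifford multiplication $\mathbb V\times{\bf S}\to{\bf S}$ (unbounded operators) is $(e_i.f)(x)=\imath x^i f(x)$, $(e_{l+i}.f)(x)=\frac{\partial f}{\partial x^i}(x)$, $1\le i\le l$, extended linearly. $L:\tilde G\to\mathcal U({\bf S})$ is the Segal-Shale-Weil (metaplectic) representation, normalized so that $L(g)(v.f)=(\kappa(g)v).(L(g)f)$. Geometric conventions. A Fedosov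 manifold is a symplectic manifold with a torsion-free affine connection preserving the symplectic form. The symplectic frame bundle of $\mathbb R^{2l}$ is trivialized by the global frame $\{e_i\}$, and the metaplectic structure is $\Lambda:\tilde G\times\mathbb R^{2l}\to G\times\mathbb R^{2l}$, $\Lambda(g,m)=(\kappa(g),m)$. The symplectic spinor bundle, associated to $\tilde G\times\mathbb R^{2l}$ via $L$, is canonically trivial, $\mathcal S={\bf S}\times\mathbb R^{2l}$, so symplectic spinor fields are maps $\phi:\mathbb R^{2l}\to{\bf S}$ (smooth sections, taking values in the smooth vectors of $L$, i.e. Schwartz functions), and the covariant derivative $\nabla^S$ induced by $\nabla$ is ordinary differentiation. Killing spinors. A non-zero symplectic spinor field $\phi$ is a symplectic Killing spinor field to the symplectic Killing spinor number $\lambda\in\mathbb C$ if $\nabla^S_X\phi=\lambda X.\phi$ for every vector field $X$. *)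

theory Defs
  imports "HOL-Probability.Sinc_Integral"
begin

section \<open>The Hilbert space of square-integrable complex functions\<close>

definition square_integrable :: "('a::euclidean_space \<Rightarrow> complex) \<Rightarrow> bool" where
  "square_integrable f \<longleftrightarrow> f \<in> borel_measurable lborel \<and> integrable lborel (\<lambda>x. (norm (f x))\<^sup>2)"

definition L2_rel :: "('a::euclidean_space \<Rightarrow> complex) \<Rightarrow> ('a \<Rightarrow> complex) \<Rightarrow> bool" where
  "L2_rel f g \<longleftrightarrow> square_integrable f \<and> square_integrable g \<and> (AE x in lborel. f x = g x)"

lemma square_integrable_zero: "square_integrable (\<lambda>x. 0)"
  by (simp add: square_integrable_def)

lemma square_integrable_scale:
  assumes "square_integrable f"
  shows "square_integrable (\<lambda>x. c * f x)"
  using assms by (auto simp: square_integrable_def norm_mult power_mult_distrib)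

lemma square_integrable_add:
  assumes "square_integrable f" "square_integrable g"
  shows "square_integrable (\<lambda>x. f x + g x)"
proof -
  have [measurable]: "f \<in> borel_measurable lborel" "g \<in> borel_measurable lborel"
    and i: "integrable lborel (\<lambda>x. (norm (f x))\<^sup>2)" "integrable lborel (\<lambda>x. (norm (g x))\<^sup>2)"
    using assms by (auto simp: square_integrable_def)
  have sum: "integrable lborel (\<lambda>x. 2 * (norm (f x))\<^sup>2 + 2 * (norm (g x))\<^sup>2)"
    using i by simp
  have bnd: "(norm (f x + g x))\<^sup>2 \<le> 2 * (norm (f x))\<^sup>2 + 2 * (norm (g x))\<^sup>2" for x
  proof -
    have "(norm (f x + g x))\<^sup>2 \<le> (norm (f x) + norm (g x))\<^sup>2"
      by (intro power_mono norm_triangle_ineq) auto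
    also have "\<dots> \<le> 2 * (norm (f x))\<^sup>2 + 2 * (norm (g x))\<^sup>2"
      using zero_le_power2[of "norm (f x) - norm (g x)"] unfolding power2_eq_square
      by (simp add: algebra_simps)
    finally show ?thesis .
  qed
  have "integrable lborel (\<lambda>x. (norm (f x + g x))\<^sup>2)"
  proof (rule Bochner_Integration.integrable_bound[OF sum])
    show "AE x in lborel. norm ((norm (f x + g x))\<^sup>2) \<le> norm (2 * (norm (f x))\<^sup>2 + 2 * (norm (g x))\<^sup>2)"
      using bnd by (intro AE_I2) simp
  qed measurable
  then show ?thesis
    by (simp add: square_integrable_def)
qed

lemma square_integrable_uminus:
  assumes "square_integrable f"
  shows "square_integrable (\<lambda>x. - f x)"
  using square_integrable_scale[OF assms, of "- 1"] by simp

lemma square_integrable_diff: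
  assumes "square_integrable f" "square_integrable g"
  shows "square_integrable (\<lambda>x. f x - g x)"
  using square_integrable_add[OF assms(1) square_integrable_uminus[OF assms(2)]] by simp

lemmas square_integrable_intros =
  square_integrable_zero square_integrable_scale square_integrable_add
  square_integrable_uminus square_integrable_diff

lemma square_integrable_inner:
  assumes "square_integrable f" "square_integrable g"
  shows "integrable lborel (\<lambda>x. f x \<bullet> g x)"
proof -
  have [measurable]: "f \<in> borel_measurable lborel" "g \<in> borel_measurable lborel"
    and i: "integrable lborel (\<lambda>x. (norm (f x))\<^sup>2)" "integrable lborel (\<lambda>x. (norm (g x))\<^sup>2)"
    using assms by (auto simp: square_integrable_def)
  have sum: "integrable lborel (\<lambda>x. (norm (f x))\<^sup>2 + (norm (g x))\<^sup>2)"
    using i by simp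
  have bnd: "\<bar>f x \<bullet> g x\<bar> \<le> (norm (f x))\<^sup>2 + (norm (g x))\<^sup>2" for x
  proof -
    have "\<bar>f x \<bullet> g x\<bar> \<le> norm (f x) * norm (g x)"
      by (rule Cauchy_Schwarz_ineq2)
    also have "\<dots> \<le> (norm (f x))\<^sup>2 + (norm (g x))\<^sup>2"
      using zero_le_power2[of "norm (f x) - norm (g x)"]
        mult_nonneg_nonneg[of "norm (f x)" "norm (g x)"] unfolding power2_eq_square
      by (simp add: algebra_simps del: mult_nonneg_nonneg zero_le_mult_iff)
    finally show ?thesis .
  qed
  show ?thesis
  proof (rule Bochner_Integration.integrable_bound[OF sum])
    show "AE x in lborel. norm (f x \<bullet> g x) \<le> norm ((norm (f x))\<^sup>2 + (norm (g x))\<^sup>2)"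
      using bnd by (intro AE_I2) simp
  qed measurable
qed

quotient_type (overloaded) 'a L2 = "'a::euclidean_space \<Rightarrow> complex" / partial: L2_rel
  morphisms L2_fun L2_of
proof (rule part_equivpI)
  show "\<exists>f. L2_rel f f"
    using square_integrable_zero by (auto simp: L2_rel_def)
  show "symp L2_rel"
    by (auto simp: symp_def L2_rel_def)
  show "transp L2_rel"
    by (auto simp: transp_def L2_rel_def)
qed

instantiation L2 :: (euclidean_space) real_vector
begin

lift_definition zero_L2 :: "'a L2" is "\<lambda>x. 0"
  by (simp add: L2_rel_def square_integrable_intros)

lift_definition plus_L2 :: "'a L2 \<Rightarrow> 'a L2 \<Rightarrow> 'a L2" is "\<lambda>f g x. f x + g x"
  by (auto simp: L2_rel_def square_integrable_intros)

lift_definition uminus_L2 :: "'a L2 \<Rightarrow> 'a L2" is "\<lambda>f x. - f x"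
  by (auto simp: L2_rel_def square_integrable_intros)

lift_definition minus_L2 :: "'a L2 \<Rightarrow> 'a L2 \<Rightarrow> 'a L2" is "\<lambda>f g x. f x - g x"
  by (auto simp: L2_rel_def square_integrable_intros)

lift_definition scaleR_L2 :: "real \<Rightarrow> 'a L2 \<Rightarrow> 'a L2" is "\<lambda>r f x. complex_of_real r * f x"
  by (auto simp: L2_rel_def square_integrable_intros)

instance
proof
  fix f g h :: "'a L2" and a b :: real
  note [simp] = L2_rel_def square_integrable_intros
  show "f + g + h = f + (g + h)"
    by transfer (simp add: add.assoc)
  show "f + g = g + f"
    by transfer (simp add: add.commute)
  show "0 + f = f"
    by transfer simp
  show "- f + f = 0"
    by transfer simp
  show "f - g = f + - g"
    by transfer (simp add: square_integrable_diff[simplified])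
  show "a *\<^sub>R (f + g) = a *\<^sub>R f + a *\<^sub>R g"
    by transfer (simp add: distrib_left)
  show "(a + b) *\<^sub>R f = a *\<^sub>R f + b *\<^sub>R f"
    by transfer (simp add: distrib_right)
  show "a *\<^sub>R b *\<^sub>R f = (a * b) *\<^sub>R f"
    by transfer (simp add: mult.assoc)
  show "1 *\<^sub>R f = f"
    by transfer simp
qed

end

text \<open>The real inner product is the real part of the Hermitian one; both induce the \<open>L\<^sup>2\<close>-norm.\<close>

instantiation L2 :: (euclidean_space) real_inner
begin

lift_definition inner_L2 :: "'a L2 \<Rightarrow> 'a L2 \<Rightarrow> real" is "\<lambda>f g. \<integral>x. f x \<bullet> g x \<partial>lborel"
proof -
  fix f f' g g' :: "'a \<Rightarrow> complex"
  assume *: "L2_rel f f'" "L2_rel g g'"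
  then have [measurable]: "f \<in> borel_measurable lborel" "g \<in> borel_measurable lborel"
      "f' \<in> borel_measurable lborel" "g' \<in> borel_measurable lborel"
    unfolding L2_rel_def square_integrable_def by blast+
  have "AE x in lborel. f x = f' x" "AE x in lborel. g x = g' x"
    using * unfolding L2_rel_def by blast+
  then have "AE x in lborel. f x \<bullet> g x = f' x \<bullet> g' x"
    by eventually_elim simp
  then show "(\<integral>x. f x \<bullet> g x \<partial>lborel) = (\<integral>x. f' x \<bullet> g' x \<partial>lborel)"
    by (intro integral_cong_AE) measurable
qed

definition norm_L2 :: "'a L2 \<Rightarrow> real" where "norm_L2 f = sqrt (f \<bullet> f)"

definition dist_L2 :: "'a L2 \<Rightarrow> 'a L2 \<Rightarrow> real" where "dist_L2 f g = norm (f - g)"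

definition sgn_L2 :: "'a L2 \<Rightarrow> 'a L2" where "sgn_L2 f = f /\<^sub>R norm f"

definition uniformity_L2 :: "('a L2 \<times> 'a L2) filter" where
  "uniformity_L2 = (INF e\<in>{0<..}. principal {(f, g). dist f g < e})"

definition open_L2 :: "'a L2 set \<Rightarrow> bool" where
  "open_L2 U \<longleftrightarrow> (\<forall>f\<in>U. eventually (\<lambda>(f', g). f' = f \<longrightarrow> g \<in> U) uniformity)"

instance
proof
  fix f g h :: "'a L2" and r :: real
  show "dist f g = norm (f - g)"
    by (simp add: dist_L2_def)
  show "sgn f = f /\<^sub>R norm f"
    by (simp add: sgn_L2_def)
  show "(uniformity :: ('a L2 \<times> 'a L2) filter)
      = (INF e\<in>{0<..}. principal {(f, g). dist f g < e})"
    by (simp add: uniformity_L2_def)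
  show "open U \<longleftrightarrow> (\<forall>f\<in>U. eventually (\<lambda>(f', g). f' = f \<longrightarrow> g \<in> U) uniformity)"
    for U :: "'a L2 set"
    by (simp add: open_L2_def)
  show "norm f = sqrt (f \<bullet> f)"
    by (simp add: norm_L2_def)
  show "f \<bullet> g = g \<bullet> f"
    by transfer (simp add: inner_commute)
  show "(f + g) \<bullet> h = f \<bullet> h + g \<bullet> h"
    by transfer (simp add: L2_rel_def inner_add_left square_integrable_inner)
  show "r *\<^sub>R f \<bullet> g = r * (f \<bullet> g)"
    by transfer (simp flip: scaleR_conv_of_real)
  show "0 \<le> f \<bullet> f"
    by transfer (simp add: inner_ge_zero)
  show "f \<bullet> f = 0 \<longleftrightarrow> f = 0"
  proof transfer
    fix f :: "'a \<Rightarrow> complex"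
    assume "L2_rel f f"
    then have f: "square_integrable f"
      by (simp add: L2_rel_def)
    have "(\<integral>x. f x \<bullet> f x \<partial>lborel) = 0 \<longleftrightarrow> (AE x in lborel. f x \<bullet> f x = 0)"
      by (rule integral_nonneg_eq_0_iff_AE[OF square_integrable_inner[OF f f]]) simp
    then show "(\<integral>x. f x \<bullet> f x \<partial>lborel) = 0 \<longleftrightarrow> L2_rel f (\<lambda>x. 0)"
      using f by (simp add: L2_rel_def square_integrable_zero)
  qed
qed

end

lift_definition scaleC :: "complex \<Rightarrow> 'a::euclidean_space L2 \<Rightarrow> 'a L2" (infixr \<open>*\<^sub>C\<close> 75)
  is "\<lambda>c f x. c * f x"
  by (auto simp: L2_rel_def square_integrable_intros)


section \<open>Smooth maps and Schwartz functions\<close>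

definition dir_deriv ::
  "'a::real_normed_vector \<Rightarrow> ('a \<Rightarrow> 'b::real_normed_vector) \<Rightarrow> 'a \<Rightarrow> 'b" where
  "dir_deriv v f x = frechet_derivative f (at x) v"

text \<open>On a finite-dimensional domain, Frechet differentiability of all iterated directional
  derivatives is the same as being infinitely often continuously differentiable.\<close>

definition smooth :: "('a::euclidean_space \<Rightarrow> 'b::real_normed_vector) \<Rightarrow> bool" where
  "smooth f \<longleftrightarrow> (\<forall>vs. fold dir_deriv vs f differentiable_on UNIV)"

definition schwartz :: "(real ^ 'l \<Rightarrow> complex) \<Rightarrow> bool" where
  "schwartz f \<longleftrightarrow> smooth f \<and>
    (\<forall>\<alpha> :: 'l \<Rightarrow> nat. \<forall>js :: 'l list.
      bounded (range (\<lambda>x. (\<Prod>i\<in>UNIV. x $ i ^ \<alpha> i) *\<^sub>R fold (\<lambda>i. dir_deriv (axis i 1)) js f x)))"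

definition schwartz_space :: "(real ^ 'l) L2 set" where
  "schwartz_space = {\<psi>. \<exists>f. schwartz f \<and> (AE x in lborel. L2_fun \<psi> x = f x)}"

definition schwartz_fun :: "(real ^ 'l) L2 \<Rightarrow> real ^ 'l \<Rightarrow> complex" where
  "schwartz_fun \<psi> = (THE f. schwartz f \<and> (AE x in lborel. L2_fun \<psi> x = f x))"


lemma smooth_differentiable:
  assumes "smooth f"
  shows "fold dir_deriv vs f differentiable_on UNIV"
  using assms by (simp add: smooth_def)

lemma schwartz_continuous: "schwartz f \<Longrightarrow> continuous_on UNIV f"
  using smooth_differentiable[of f "[]"]
  by (simp add: schwartz_def differentiable_imp_continuous_on)

lemma schwartz_dir_deriv_continuous:
  "schwartz f \<Longrightarrow> continuous_on UNIV (dir_deriv v f)"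
  using smooth_differentiable[of f "[v]"]
  by (simp add: schwartz_def differentiable_imp_continuous_on)

lemma schwartz_AE_eq:
  assumes "schwartz f" "schwartz g" "AE x in lborel. f x = g x"
  shows "f = g"
proof
  fix x
  have "closed {x. f x = g x}"
    using assms by (intro closed_Collect_eq schwartz_continuous)
  moreover have "AE x in lebesgue. x \<in> {x. f x = g x}"
    using AE_completion[OF assms(3)] by simp
  ultimately show "f x = g x"
    using mem_closed_if_AE_lebesgue by blast
qed

lemma schwartz_fun_eq:
  assumes "schwartz f" "AE x in lborel. L2_fun \<psi> x = f x"
  shows "schwartz_fun \<psi> = f"
  unfolding schwartz_fun_def
proof (rule the_equality)
  fix g
  assume g: "schwartz g \<and> (AE x in lborel. L2_fun \<psi> x = g x)"
  then have "AE x in lborel. L2_fun \<psi> x = g x"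
    by blast
  with assms(2) have "AE x in lborel. g x = f x"
    by eventually_elim simp
  with g assms(1) show "g = f"
    using schwartz_AE_eq by blast
qed (use assms in blast)

text \<open>The functions to which \<open>L2_of\<close> is applied in the Clifford multiplication below are
  square-integrable.\<close>

lemma integrable_prod_inverse_1_plus_square:
  "integrable lborel (\<lambda>x :: 'a::euclidean_space. \<Prod>b\<in>Basis. inverse (1 + (x \<bullet> b)\<^sup>2))"
proof (rule integrableI_nonneg)
  have r: "(\<integral>\<^sup>+x. ennreal (inverse (1 + x\<^sup>2)) \<partial>lborel) < \<infinity>"
    using integrable_inverse_1_plus_square
    by (simp add: set_integrable_def real_integrable_def less_top integrable_iff_bounded)
  have "(\<integral>\<^sup>+(x::'a). ennreal (\<Prod>b\<in>Basis. inverse (1 + (x \<bullet> b)\<^sup>2)) \<partial>lborel)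
      = (\<integral>\<^sup>+(x::'a). (\<Prod>b\<in>Basis. ennreal (inverse (1 + (x \<bullet> b)\<^sup>2))) \<partial>lborel)"
    by (intro nn_integral_cong prod_ennreal[symmetric]) simp
  also have "\<dots> = (\<Prod>b\<in>(Basis::'a set). (\<integral>\<^sup>+x. ennreal (inverse (1 + x\<^sup>2)) \<partial>lborel))"
    by (rule nn_integral_lborel_prod) auto
  also have "\<dots> < \<infinity>"
    using r by (simp add: power_less_top_ennreal)
  finally show "(\<integral>\<^sup>+(x::'a). ennreal (\<Prod>b\<in>Basis. inverse (1 + (x \<bullet> b)\<^sup>2)) \<partial>lborel) < \<infinity>" .
qed (auto intro!: prod_nonneg)

lemma square_integrable_rapidly_decreasing:
  fixes h :: "real ^ 'l \<Rightarrow> complex"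
  assumes cont: "continuous_on UNIV h"
    and bnd: "\<And>\<alpha> :: 'l \<Rightarrow> nat. bounded (range (\<lambda>x. (\<Prod>i\<in>UNIV. x $ i ^ \<alpha> i) *\<^sub>R h x))"
  shows "square_integrable h"
proof -
  define p where "p x = (\<Prod>i\<in>UNIV. 1 + (x $ i)\<^sup>2)" for x :: "real ^ 'l"
  have "\<exists>B. \<forall>x. norm ((\<Prod>i\<in>UNIV. x $ i ^ \<alpha> i) *\<^sub>R h x) \<le> B" for \<alpha> :: "'l \<Rightarrow> nat"
    using bnd[of \<alpha>] unfolding bounded_iff by blast
  then obtain B where B: "norm ((\<Prod>i\<in>UNIV. x $ i ^ \<alpha> i) *\<^sub>R h x) \<le> B \<alpha>" for x and \<alpha> :: "'l \<Rightarrow> nat"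
    by metis
  define C where "C = (\<Sum>S\<in>Pow UNIV. B (\<lambda>i :: 'l. if i \<in> S then 0 else 2))"
  have p1: "1 \<le> p x" for x
    unfolding p_def by (rule prod_ge_1) simp
  have C: "p x * norm (h x) \<le> C" for x
  proof -
    have "p x = (\<Sum>S\<in>Pow UNIV. (\<Prod>i\<in>UNIV. x $ i ^ (if i \<in> S then 0 else 2)))"
    proof -
      have "(\<Prod>i\<in>S. 1) * (\<Prod>i\<in>UNIV - S. (x $ i)\<^sup>2)
          = (\<Prod>i\<in>UNIV. x $ i ^ (if i \<in> S then 0 else 2))" for S
      proof -
        have "(\<Prod>i\<in>UNIV - S. (x $ i)\<^sup>2) = (\<Prod>i\<in>UNIV. x $ i ^ (if i \<in> S then 0 else 2))"
          by (rule prod.mono_neutral_cong_left) auto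
        then show ?thesis by simp
      qed
      then show ?thesis
        unfolding p_def by (subst prod_add) auto
    qed
    then have "p x * norm (h x)
        = norm (\<Sum>S\<in>Pow UNIV. (\<Prod>i\<in>UNIV. x $ i ^ (if i \<in> S then 0 else 2)) *\<^sub>R h x)"
      using p1[of x] by (simp flip: scaleR_sum_left)
    also have "\<dots> \<le> C"
      unfolding C_def by (intro sum_norm_le B)
    finally show ?thesis .
  qed
  have "integrable lborel (\<lambda>x :: real ^ 'l. C\<^sup>2 * (\<Prod>b\<in>Basis. inverse (1 + (x \<bullet> b)\<^sup>2)))"
    by (intro integrable_mult_right integrable_prod_inverse_1_plus_square)
  also have "(\<lambda>x :: real ^ 'l. \<Prod>b\<in>Basis. inverse (1 + (x \<bullet> b)\<^sup>2)) = (\<lambda>x. inverse (p x))"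
  proof
    fix x :: "real ^ 'l"
    have basis: "(Basis :: (real ^ 'l) set) = (\<lambda>i. axis i 1) ` UNIV"
      by (auto simp: Basis_vec_def)
    have "inj (\<lambda>i :: 'l. axis i (1 :: real))"
      by (auto simp: inj_def axis_eq_axis)
    then have "(\<Prod>b\<in>Basis. inverse (1 + (x \<bullet> b)\<^sup>2)) = (\<Prod>i\<in>UNIV. inverse (1 + (x $ i)\<^sup>2))"
      unfolding basis by (subst prod.reindex) (auto simp: inner_axis)
    also have "\<dots> = inverse (p x)"
      using prod_inversef[of "\<lambda>i. 1 + (x $ i)\<^sup>2" UNIV] by (simp add: p_def comp_def)
    finally show "(\<Prod>b\<in>Basis. inverse (1 + (x \<bullet> b)\<^sup>2)) = inverse (p x)" .
  qed
  finally have dom: "integrable lborel (\<lambda>x :: real ^ 'l. C\<^sup>2 * inverse (p x))" .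
  have [measurable]: "h \<in> borel_measurable lborel"
    using borel_measurable_continuous_onI[OF cont] by simp
  have "integrable lborel (\<lambda>x. (norm (h x))\<^sup>2)"
  proof (rule Bochner_Integration.integrable_bound[OF dom])
    show "AE x in lborel. norm ((norm (h x))\<^sup>2) \<le> norm (C\<^sup>2 * inverse (p x))"
    proof (rule AE_I2)
      fix x
      have "(norm (h x))\<^sup>2 * p x \<le> (norm (h x))\<^sup>2 * (p x)\<^sup>2"
        using p1[of x] self_le_power[of "p x" 2] by (intro mult_left_mono) auto
      also have "\<dots> = (p x * norm (h x))\<^sup>2"
        by (simp add: power_mult_distrib mult.commute)
      also have "\<dots> \<le> C\<^sup>2"
        using C[of x] p1[of x] by (intro power_mono) auto
      finally have "(norm (h x))\<^sup>2 \<le> C\<^sup>2 * inverse (p x)"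
        using p1[of x] by (simp add: field_simps)
      then show "norm ((norm (h x))\<^sup>2) \<le> norm (C\<^sup>2 * inverse (p x))"
        using p1[of x] by simp
    qed
  qed measurable
  then show ?thesis
    by (simp add: square_integrable_def)
qed

lemma schwartz_square_integrable:
  assumes "schwartz f"
  shows "square_integrable f"
    and "square_integrable (\<lambda>x. \<i> * complex_of_real (x $ i) * f x)"
    and "square_integrable (dir_deriv (axis i 1) f)"
proof -
  have bnd: "bounded (range (\<lambda>x. (\<Prod>j\<in>UNIV. x $ j ^ \<alpha> j) *\<^sub>R
      fold (\<lambda>j. dir_deriv (axis j 1)) js f x))" for \<alpha> js
    using assms by (simp add: schwartz_def)
  show "square_integrable f"
    using assms bnd[of _ "[]"]
    by (intro square_integrable_rapidly_decreasing schwartz_continuous) auto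
  show "square_integrable (dir_deriv (axis i 1) f)"
    using assms bnd[of _ "[i]"]
    by (intro square_integrable_rapidly_decreasing schwartz_dir_deriv_continuous) auto
  show "square_integrable (\<lambda>x. \<i> * complex_of_real (x $ i) * f x)"
  proof (rule square_integrable_rapidly_decreasing)
    show "continuous_on UNIV (\<lambda>x. \<i> * complex_of_real (x $ i) * f x)"
      by (intro continuous_intros schwartz_continuous[OF assms])
    fix \<alpha> :: "'a \<Rightarrow> nat"
    have "(\<Prod>j\<in>UNIV. x $ j ^ (\<alpha>(i := Suc (\<alpha> i))) j)
        = x $ i * (\<Prod>j\<in>UNIV. x $ j ^ \<alpha> j)" for x :: "real ^ 'a"
      by (simp add: prod.remove[of UNIV i] algebra_simps)
    then show "bounded (range (\<lambda>x. (\<Prod>j\<in>UNIV. x $ j ^ \<alpha> j) *\<^sub>R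
        (\<i> * complex_of_real (x $ i) * f x)))"
      using bnd[of "\<alpha>(i := Suc (\<alpha> i))" "[]"]
      by (simp add: bounded_iff norm_mult abs_mult mult_ac)
  qed
qed


section \<open>Symplectic Clifford multiplication\<close>

text \<open>Points of \<open>\<real>\<^sup>2\<^sup>l\<close> have type \<open>real ^ ('l + 'l)\<close>: the coordinate \<open>s\<^sup>i\<close> has index \<open>Inl i\<close>,
  the coordinate \<open>t\<^sup>i\<close> has index \<open>Inr i\<close>. The operators below are unbounded on \<open>L\<^sup>2\<close>; they are
  meaningful on \<open>schwartz_space\<close> only.\<close>

definition clifford_s :: "'l \<Rightarrow> (real ^ 'l::finite) L2 \<Rightarrow> (real ^ 'l) L2" where
  "clifford_s i \<psi> = L2_of (\<lambda>x. \<i> * complex_of_real (x $ i) * schwartz_fun \<psi> x)"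

definition clifford_t :: "'l \<Rightarrow> (real ^ 'l::finite) L2 \<Rightarrow> (real ^ 'l) L2" where
  "clifford_t i \<psi> = L2_of (dir_deriv (axis i 1) (schwartz_fun \<psi>))"

definition clifford :: "real ^ ('l + 'l) \<Rightarrow> (real ^ 'l::finite) L2 \<Rightarrow> (real ^ 'l) L2" where
  "clifford v \<psi> =
    (\<Sum>i\<in>UNIV. v $ Inl i *\<^sub>R clifford_s i \<psi>) + (\<Sum>i\<in>UNIV. v $ Inr i *\<^sub>R clifford_t i \<psi>)"


section \<open>Symplectic Killing spinors on the flat symplectic vector space\<close>

text \<open>The global parallel symplectic frame trivializes the spinor bundle: spinor fields are
  \<open>L\<^sup>2\<close>-valued maps on \<open>\<real>\<^sup>2\<^sup>l\<close>, and the induced covariant derivative is the ordinary derivative.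
  Smoothness is meant with respect to the \<open>L\<^sup>2\<close>-norm, which is weaker than smoothness with respect
  to the Frechet topology of the Schwartz space.\<close>

definition symplectic_spinor_field :: "(real ^ ('l + 'l) \<Rightarrow> (real ^ 'l::finite) L2) \<Rightarrow> bool" where
  "symplectic_spinor_field \<phi> \<longleftrightarrow> smooth \<phi> \<and> (\<forall>m. \<phi> m \<in> schwartz_space)"

definition spinor_derivative ::
  "(real ^ ('l + 'l) \<Rightarrow> real ^ ('l + 'l)) \<Rightarrow> (real ^ ('l + 'l) \<Rightarrow> (real ^ 'l::finite) L2) \<Rightarrow>
    real ^ ('l + 'l) \<Rightarrow> (real ^ 'l) L2" where
  "spinor_derivative X \<phi> m = dir_deriv (X m) \<phi> m"

definition symplectic_killing_spinor_field ::
  "complex \<Rightarrow> (real ^ ('l + 'l) \<Rightarrow> (real ^ 'l::finite) L2) \<Rightarrow> bool" where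
  "symplectic_killing_spinor_field lam \<phi> \<longleftrightarrow>
    symplectic_spinor_field \<phi> \<and> \<phi> \<noteq> (\<lambda>m. 0) \<and>
    (\<forall>X. smooth X \<longrightarrow> (\<forall>m. spinor_derivative X \<phi> m = lam *\<^sub>C clifford (X m) (\<phi> m)))"

definition symplectic_killing_spinor_numbers :: "'l::finite itself \<Rightarrow> complex set" where
  "symplectic_killing_spinor_numbers _ =
    {lam. \<exists>\<phi> :: real ^ ('l + 'l) \<Rightarrow> (real ^ 'l) L2. symplectic_killing_spinor_field lam \<phi>}"

end

theory Submission
  imports Defs
begin

text \<open>Suppose \<open>\<lambda> \<noteq> 0\<close>. The derivatives of a Killing spinor field \<open>\<phi>\<close> in the directions \<open>s\<^sup>i\<close> and \<open>t\<^sup>i\<close> are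
  \<open>\<lambda> A \<phi>\<close> and \<open>\<lambda> D \<phi>\<close>, where \<open>A\<close> is multiplication by \<open>\<i> x\<^sup>i\<close> and \<open>D\<close> is the \<open>i\<close>-th partial derivative.
  Second derivatives of \<open>\<phi>\<close> commute, whereas the commutator of \<open>D\<close> and \<open>A\<close> is the scalar \<open>\<i>\<close>; hence \<open>\<phi> = 0\<close>.
  As \<open>A\<close> and \<open>D\<close> are unbounded on \<open>L\<^sup>2\<close>, they cannot be interchanged with an \<open>L\<^sup>2\<close>-limit. Instead, the
  second derivatives at \<open>m\<close> are paired with a multiple of \<open>\<phi> m\<close>, to which the skew-adjoint operators \<open>A\<close> and \<open>D\<close>
  are moved. The commutator relation then is integration by parts in \<open>\<integral> x\<^sup>i \<bar>\<phi> m\<bar>\<^sup>2\<close>.\<close>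

section \<open>Directional derivatives and the symmetry of second derivatives\<close>

lemma has_vector_derivative_dir_deriv:
  assumes "f differentiable at (x + t *\<^sub>R v)"
  shows "((\<lambda>t. f (x + t *\<^sub>R v)) has_vector_derivative dir_deriv v f (x + t *\<^sub>R v)) (at t)"
proof -
  have D: "(f has_derivative frechet_derivative f (at (x + t *\<^sub>R v))) (at (x + t *\<^sub>R v))"
    using assms by (simp add: frechet_derivative_works)
  have "((\<lambda>t. x + t *\<^sub>R v) has_derivative (\<lambda>h. h *\<^sub>R v)) (at t)"
    by (auto intro!: derivative_eq_intros)
  from diff_chain_at[OF this D] show ?thesis
    using linear_scale[OF linear_frechet_derivative[OF assms]]
    by (simp add: has_vector_derivative_def dir_deriv_def o_def)
qed

lemma dir_deriv_eqI: "(f has_derivative f') (at x) \<Longrightarrow> dir_deriv v f x = f' v"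
  unfolding dir_deriv_def using frechet_derivative_at[of f f' x] by simp

lemma dir_deriv_inner_left:
  fixes f :: "'a::real_normed_vector \<Rightarrow> 'b::real_inner"
  assumes "f differentiable at x"
  shows "(\<lambda>x. f x \<bullet> g) differentiable at x"
    and "dir_deriv v (\<lambda>x. f x \<bullet> g) x = dir_deriv v f x \<bullet> g"
proof -
  have "((\<lambda>x. f x \<bullet> g) has_derivative (\<lambda>h. frechet_derivative f (at x) h \<bullet> g)) (at x)"
    using assms by (intro has_derivative_inner_left) (simp add: frechet_derivative_works)
  then show "(\<lambda>x. f x \<bullet> g) differentiable at x"
    and "dir_deriv v (\<lambda>x. f x \<bullet> g) x = dir_deriv v f x \<bullet> g"
    by (auto simp: differentiable_def dir_deriv_eqI) (simp add: dir_deriv_def)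
qed

text \<open>The mean value theorem is applied twice: along \<open>u\<close> to the difference
  \<open>g\<close> of \<open>f\<close> on two segments that are \<open>h *\<^sub>R v\<close> apart,
  then along \<open>v\<close> to \<open>dir_deriv u f\<close>. The left-hand side is symmetric in
  \<open>u\<close> and \<open>v\<close>, the right-hand side is not visibly so.\<close>

lemma second_difference_mean_value:
  fixes f :: "'a::real_normed_vector \<Rightarrow> real"
  assumes f: "\<And>x. f differentiable at x" and fu: "\<And>x. dir_deriv u f differentiable at x"
    and h: "h > 0"
  obtains \<xi> \<eta> where "0 < \<xi>" "\<xi> < h" "0 < \<eta>" "\<eta> < h"
    "f (x + h *\<^sub>R u + h *\<^sub>R v) - f (x + h *\<^sub>R u) - f (x + h *\<^sub>R v) + f x
      = h * h * dir_deriv v (dir_deriv u f) (x + \<xi> *\<^sub>R u + \<eta> *\<^sub>R v)"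
proof -
  define g where "g t = f ((x + h *\<^sub>R v) + t *\<^sub>R u) - f (x + t *\<^sub>R u)" for t
  have "(g has_real_derivative dir_deriv u f ((x + h *\<^sub>R v) + t *\<^sub>R u) - dir_deriv u f (x + t *\<^sub>R u))
      (at t)" for t
    using has_vector_derivative_dir_deriv[OF f] unfolding g_def
    by (intro DERIV_diff) (simp_all add: has_real_derivative_iff_has_vector_derivative)
  from MVT2[OF h this] obtain \<xi> where \<xi>: "0 < \<xi>" "\<xi> < h"
      "g h - g 0 = h * (dir_deriv u f ((x + h *\<^sub>R v) + \<xi> *\<^sub>R u) - dir_deriv u f (x + \<xi> *\<^sub>R u))"
    by auto
  have "((\<lambda>t. dir_deriv u f ((x + \<xi> *\<^sub>R u) + t *\<^sub>R v)) has_real_derivative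
      dir_deriv v (dir_deriv u f) ((x + \<xi> *\<^sub>R u) + t *\<^sub>R v)) (at t)" for t
    using has_vector_derivative_dir_deriv[OF fu]
    by (simp add: has_real_derivative_iff_has_vector_derivative)
  from MVT2[OF h this] obtain \<eta> where \<eta>: "0 < \<eta>" "\<eta> < h"
      "dir_deriv u f ((x + \<xi> *\<^sub>R u) + h *\<^sub>R v) - dir_deriv u f ((x + \<xi> *\<^sub>R u) + 0 *\<^sub>R v)
        = h * dir_deriv v (dir_deriv u f) ((x + \<xi> *\<^sub>R u) + \<eta> *\<^sub>R v)"
    by auto
  show thesis
    using \<xi> \<eta> by (intro that[of \<xi> \<eta>]) (auto simp: g_def algebra_simps)
qed

text \<open>Divided by the square of the step, the symmetric second difference converges to either
  mixed derivative, by continuity; limits are unique.\<close>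

lemma dir_deriv_commute_real:
  fixes f :: "'a::real_normed_vector \<Rightarrow> real"
  assumes f: "\<And>x. f differentiable at x"
    and fu: "\<And>x. dir_deriv u f differentiable at x"
    and fv: "\<And>x. dir_deriv v f differentiable at x"
    and uv: "continuous_on UNIV (dir_deriv v (dir_deriv u f))"
    and vu: "continuous_on UNIV (dir_deriv u (dir_deriv v f))"
  shows "dir_deriv v (dir_deriv u f) x = dir_deriv u (dir_deriv v f) x"
proof -
  define h where "h n = inverse (real (Suc n))" for n
  have h: "h n > 0" for n by (simp add: h_def)
  have h0: "h \<longlonglongrightarrow> 0"
    unfolding h_def by (rule LIMSEQ_inverse_real_of_nat)
  define D where "D n = f (x + h n *\<^sub>R u + h n *\<^sub>R v) - f (x + h n *\<^sub>R u)
    - f (x + h n *\<^sub>R v) + f x" for n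
  \<comment> \<open>Stated for generic directions so that it serves for (\<open>u\<close>,
    \<open>v\<close>) and for (\<open>v\<close>, \<open>u\<close>) with one and the same sequence
    \<open>D\<close>.\<close>
  have *: "(\<lambda>n. D n / (h n * h n)) \<longlonglongrightarrow> dir_deriv b (dir_deriv a f) x"
    if d: "\<And>x. dir_deriv a f differentiable at x"
      and c: "continuous_on UNIV (dir_deriv b (dir_deriv a f))"
      and D: "\<And>n. D n = f (x + h n *\<^sub>R a + h n *\<^sub>R b) - f (x + h n *\<^sub>R a) - f (x + h n *\<^sub>R b) + f x"
    for a b
  proof -
    have "\<forall>n. \<exists>p. 0 < fst p \<and> fst p < h n \<and> 0 < snd p \<and> snd p < h n \<and>
        D n = h n * h n * dir_deriv b (dir_deriv a f) (x + fst p *\<^sub>R a + snd p *\<^sub>R b)"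
    proof
      fix n
      show "\<exists>p. 0 < fst p \<and> fst p < h n \<and> 0 < snd p \<and> snd p < h n \<and>
          D n = h n * h n * dir_deriv b (dir_deriv a f) (x + fst p *\<^sub>R a + snd p *\<^sub>R b)"
        by (rule second_difference_mean_value[OF f d h[of n], of x b]) (use D[of n] in auto)
    qed
    from choice[OF this] obtain p where p: "0 < fst (p n)" "fst (p n) < h n" "0 < snd (p n)" "snd (p n) < h n"
        "D n = h n * h n * dir_deriv b (dir_deriv a f) (x + fst (p n) *\<^sub>R a + snd (p n) *\<^sub>R b)" for n
      by blast
    have "(\<lambda>n. fst (p n)) \<longlonglongrightarrow> 0" "(\<lambda>n. snd (p n)) \<longlonglongrightarrow> 0"
      by (rule tendsto_sandwich[OF _ _ tendsto_const h0]; simp add: p less_imp_le)+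
    then have "(\<lambda>n. x + fst (p n) *\<^sub>R a + snd (p n) *\<^sub>R b) \<longlonglongrightarrow> x + 0 *\<^sub>R a + 0 *\<^sub>R b"
      by (intro tendsto_intros)
    then have lim: "(\<lambda>n. x + fst (p n) *\<^sub>R a + snd (p n) *\<^sub>R b) \<longlonglongrightarrow> x"
      by simp
    have "isCont (dir_deriv b (dir_deriv a f)) x"
      using c by (simp add: continuous_on_eq_continuous_at)
    from isCont_tendsto_compose[OF this lim]
    have "(\<lambda>n. dir_deriv b (dir_deriv a f) (x + fst (p n) *\<^sub>R a + snd (p n) *\<^sub>R b))
        \<longlonglongrightarrow> dir_deriv b (dir_deriv a f) x" .
    moreover have "D n / (h n * h n) = dir_deriv b (dir_deriv a f) (x + fst (p n) *\<^sub>R a + snd (p n) *\<^sub>R b)" for n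
      using h[of n] p(5)[of n] by simp
    ultimately show ?thesis by simp
  qed
  show ?thesis
  proof (rule LIMSEQ_unique[OF *[OF fu uv D_def] *[OF fv vu]])
    show "D n = f (x + h n *\<^sub>R v + h n *\<^sub>R u) - f (x + h n *\<^sub>R v) - f (x + h n *\<^sub>R u) + f x" for n
      unfolding D_def add.assoc add.commute[of "h n *\<^sub>R u" "h n *\<^sub>R v"] by simp
  qed
qed

lemma smooth_differentiable_at:
  assumes "smooth f"
  shows "fold dir_deriv vs f differentiable at x"
  using smooth_differentiable[OF assms, of vs] by (simp add: differentiable_on_def)

text \<open>The mean value theorem is about real functions. Pairing with a fixed \<open>g\<close>
  reduces to that case, and a vector is determined by its inner products with all
  \<open>g\<close>.\<close>

lemma dir_deriv_commute:
  fixes f :: "'a::euclidean_space \<Rightarrow> 'b::real_inner"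
  assumes "smooth f"
  shows "dir_deriv v (dir_deriv u f) x = dir_deriv u (dir_deriv v f) x"
proof -
  note d = smooth_differentiable_at[OF assms]
  have d0: "f differentiable at x" for x
    using d[of "[]"] by simp
  have d1: "dir_deriv a f differentiable at x" for a x
    using d[of "[a]"] by simp
  have d2: "dir_deriv b (dir_deriv a f) differentiable at x" for a b x
    using d[of "[a, b]"] by simp
  have 1: "dir_deriv a (\<lambda>x. f x \<bullet> g) = (\<lambda>x. dir_deriv a f x \<bullet> g)" for a g
    using dir_deriv_inner_left(2)[OF d0] by auto
  have 2: "dir_deriv b (\<lambda>x. dir_deriv a f x \<bullet> g) = (\<lambda>x. dir_deriv b (dir_deriv a f) x \<bullet> g)" for a b g
    using dir_deriv_inner_left(2)[OF d1] by auto
  have "continuous_on UNIV (dir_deriv b (dir_deriv a f))" for a b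
    by (simp add: continuous_at_imp_continuous_on differentiable_imp_continuous_within d2)
  then have "dir_deriv v (dir_deriv u f) x \<bullet> g = dir_deriv u (dir_deriv v f) x \<bullet> g" for g
    using dir_deriv_commute_real[of "\<lambda>x. f x \<bullet> g" u v x]
    by (simp add: 1 2 dir_deriv_inner_left d0 d1 continuous_on_inner)
  then show ?thesis
    by (metis vector_eq_rdot)
qed

section \<open>Integration by parts on Euclidean space\<close>

lemma
  fixes f :: "'a::euclidean_space \<Rightarrow> real"
  assumes f: "integrable lborel f"
  shows integrable_lborel_shift: "integrable lborel (\<lambda>x. f (x + c))"
    and integral_lborel_shift: "(\<integral>x. f (x + c) \<partial>lborel) = integral\<^sup>L lborel f"
proof -
  have [measurable]: "f \<in> borel_measurable borel"
    using borel_measurable_integrable[OF f] by simp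
  have "integrable (distr lborel borel ((+) c)) f"
    unfolding lborel_distr_plus by (rule f)
  then have "integrable lborel (\<lambda>x. f (c + x))"
    by (subst (asm) integrable_distr_eq) measurable
  then show "integrable lborel (\<lambda>x. f (x + c))"
    by (simp add: add.commute)
  have "integral\<^sup>L lborel f = integral\<^sup>L (distr lborel borel ((+) c)) f"
    unfolding lborel_distr_plus ..
  also have "\<dots> = (\<integral>x. f (c + x) \<partial>lborel)"
    by (rule integral_distr) measurable
  finally show "(\<integral>x. f (x + c) \<partial>lborel) = integral\<^sup>L lborel f"
    by (simp add: add.commute)
qed

text \<open>The integral of \<open>\<lambda>x. f (x + v) - f x\<close> vanishes by translation invariance; by Fubini, it is also
  the average over \<open>t \<in> {0..1}\<close> of the integrals of \<open>\<lambda>x. dir_deriv v f (x + t *\<^sub>R v)\<close>, which all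
  equal the integral in question.\<close>

lemma integral_dir_deriv_eq_0:
  fixes f :: "'a::euclidean_space \<Rightarrow> real"
  assumes f: "\<And>x. f differentiable at x" and c: "continuous_on UNIV (dir_deriv v f)"
    and i: "integrable lborel f" "integrable lborel (dir_deriv v f)"
  shows "integral\<^sup>L lborel (dir_deriv v f) = 0"
proof -
  define d where "d = dir_deriv v f"
  note c = c[folded d_def] and i = i[folded d_def]
  define g where "g t x = indicator {0..1} t *\<^sub>R d (x + t *\<^sub>R v)" for t :: real and x
  have [measurable]: "d \<in> borel_measurable borel"
    using c by (rule borel_measurable_continuous_onI)
  have "integrable (lborel \<Otimes>\<^sub>M lborel) (case_prod g)"
  proof (rule lborel_pair.Fubini_integrable)
    show "case_prod g \<in> borel_measurable (lborel \<Otimes>\<^sub>M lborel)"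
      unfolding g_def by measurable
    \<comment> \<open>By translation invariance this integral is the same for all t in the unit
      interval, hence integrable in t.\<close>
    have "(\<integral>x. norm (g t x) \<partial>lborel) = indicator {0..1} t * integral\<^sup>L lborel (\<lambda>x. \<bar>d x\<bar>)" for t
      using integral_lborel_shift[of "\<lambda>x. \<bar>d x\<bar>" "t *\<^sub>R v"] i
      by (simp add: g_def abs_mult)
    then show "integrable lborel (\<lambda>t. \<integral>x. norm (case_prod g (t, x)) \<partial>lborel)"
      by simp
    show "AE t in lborel. integrable lborel (\<lambda>x. case_prod g (t, x))"
      using integrable_lborel_shift[OF i(2)] by (simp add: g_def)
  qed
  then have fub: "(\<integral>x. (\<integral>t. g t x \<partial>lborel) \<partial>lborel) = (\<integral>t. (\<integral>x. g t x \<partial>lborel) \<partial>lborel)"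
    by (rule lborel_pair.Fubini_integral[where f = g])
  have "(\<integral>x. (\<integral>t. g t x \<partial>lborel) \<partial>lborel) = (\<integral>x. f (x + v) - f x \<partial>lborel)"
  proof (rule Bochner_Integration.integral_cong)
    fix x
    have "(\<integral>t. g t x \<partial>lborel) = f (x + 1 *\<^sub>R v) - f (x + 0 *\<^sub>R v)"
      unfolding g_def
    proof (rule integral_FTC_atLeastAtMost)
      show "((\<lambda>t. f (x + t *\<^sub>R v)) has_vector_derivative d (x + t *\<^sub>R v)) (at t within {0..1})"
        for t
        unfolding d_def by (rule has_vector_derivative_at_within[OF has_vector_derivative_dir_deriv[OF f]])
      show "continuous_on {0..1} (\<lambda>t. d (x + t *\<^sub>R v))"
        by (intro continuous_on_compose2[OF c] continuous_intros) auto
    qed simp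
    then show "(\<integral>t. g t x \<partial>lborel) = f (x + v) - f x" by simp
  qed simp
  also have "\<dots> = 0"
    using i integral_lborel_shift[OF i(1)] integrable_lborel_shift[OF i(1)] by simp
  finally have "(\<integral>t. (\<integral>x. g t x \<partial>lborel) \<partial>lborel) = 0"
    using fub by simp
  moreover have "(\<integral>x. g t x \<partial>lborel) = indicator {0..1} t * integral\<^sup>L lborel d" for t
    using integral_lborel_shift[OF i(2)] by (simp add: g_def)
  ultimately have "integral\<^sup>L lborel d = 0" by simp
  then show ?thesis by (simp add: d_def)
qed

text \<open>By the product rule, the two integrands add up to the derivative of
  \<open>f x \<bullet> g x\<close>, whose integral vanishes. The integrability assumptions stand in
  for decay at infinity.\<close>

lemma integral_by_parts_dir_deriv:
  fixes f g :: "'a::euclidean_space \<Rightarrow> 'b::real_inner"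
  assumes f: "\<And>x. f differentiable at x" "continuous_on UNIV (dir_deriv v f)"
    and g: "\<And>x. g differentiable at x" "continuous_on UNIV (dir_deriv v g)"
    and i: "integrable lborel (\<lambda>x. f x \<bullet> g x)" "integrable lborel (\<lambda>x. dir_deriv v f x \<bullet> g x)"
      "integrable lborel (\<lambda>x. f x \<bullet> dir_deriv v g x)"
  shows "(\<integral>x. dir_deriv v f x \<bullet> g x \<partial>lborel) = - (\<integral>x. f x \<bullet> dir_deriv v g x \<partial>lborel)"
proof -
  have D: "((\<lambda>x. f x \<bullet> g x) has_derivative
      (\<lambda>h. f x \<bullet> frechet_derivative g (at x) h + frechet_derivative f (at x) h \<bullet> g x)) (at x)" for x
    using f(1) g(1) by (intro has_derivative_inner) (simp_all add: frechet_derivative_works)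
  have d: "(\<lambda>x. f x \<bullet> g x) differentiable at x" for x
    using D by (auto simp: differentiable_def)
  have e: "dir_deriv v (\<lambda>x. f x \<bullet> g x) = (\<lambda>x. f x \<bullet> dir_deriv v g x + dir_deriv v f x \<bullet> g x)"
    using dir_deriv_eqI[OF D] by (auto simp: dir_deriv_def)
  have "continuous_on UNIV f" "continuous_on UNIV g"
    using f(1) g(1) by (auto intro!: continuous_at_imp_continuous_on differentiable_imp_continuous_within)
  then have "continuous_on UNIV (\<lambda>x. f x \<bullet> dir_deriv v g x + dir_deriv v f x \<bullet> g x)"
    using f(2) g(2) by (intro continuous_on_add continuous_on_inner)
  with integral_dir_deriv_eq_0[OF d, of v] i show ?thesis
    by (simp add: e)
qed

section \<open>Complex scalars and Schwartz representatives in the Hilbert space\<close>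

lemma inner_L2_of:
  assumes "square_integrable f" "square_integrable g"
  shows "L2_of f \<bullet> L2_of g = (\<integral>x. f x \<bullet> g x \<partial>lborel)"
  using assms by (intro inner_L2.abs_eq) (simp_all add: L2_rel_def)

lemma scaleC_L2_of: "square_integrable f \<Longrightarrow> c *\<^sub>C L2_of f = L2_of (\<lambda>x. c * f x)"
  by (rule scaleC.abs_eq) (simp add: L2_rel_def)

lemma scaleC_scaleC: "c *\<^sub>C d *\<^sub>C \<psi> = (c * d) *\<^sub>C \<psi>"
  by transfer (simp add: L2_rel_def square_integrable_scale mult.assoc)

lemma scaleC_minus_left: "(- c) *\<^sub>C \<psi> = - (c *\<^sub>C \<psi>)"
  by transfer (simp add: L2_rel_def square_integrable_scale square_integrable_uminus)

lemma scaleC_zero_left: "0 *\<^sub>C \<psi> = 0"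
  by transfer (simp add: L2_rel_def square_integrable_zero)

text \<open>The real inner product is the real part of the Hermitian one, so the adjoint of
  multiplication by \<open>c\<close> is multiplication by \<open>cnj c\<close>.\<close>

lemma inner_scaleC_left: "c *\<^sub>C \<psi> \<bullet> \<theta> = \<psi> \<bullet> cnj c *\<^sub>C \<theta>"
proof -
  have "(c * z) \<bullet> w = z \<bullet> (cnj c * w)" for z w
    by (simp add: inner_complex_def algebra_simps)
  then show ?thesis
    by transfer simp
qed

text \<open>Permits replacing an equivalence class by its Schwartz representative in all later
  integrals.\<close>

lemma schwartz_fun:
  assumes "\<psi> \<in> schwartz_space"
  shows schwartz_schwartz_fun: "schwartz (schwartz_fun \<psi>)"
    and L2_of_schwartz_fun: "L2_of (schwartz_fun \<psi>) = \<psi>"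
proof -
  obtain f where f: "schwartz f" "AE x in lborel. L2_fun \<psi> x = f x"
    using assms by (auto simp: schwartz_space_def)
  have eq: "schwartz_fun \<psi> = f"
    using f by (rule schwartz_fun_eq)
  with f show "schwartz (schwartz_fun \<psi>)" by simp
  have "L2_rel (L2_fun \<psi>) (L2_fun \<psi>)"
    by (rule Quotient3_rep_reflp[OF Quotient3_L2])
  then have "L2_rel (L2_fun \<psi>) f"
    using f schwartz_square_integrable(1)[OF f(1)] by (simp add: L2_rel_def)
  then have "L2_of (L2_fun \<psi>) = L2_of f"
    by (rule Quotient3_rel_abs[OF Quotient3_L2])
  from this[symmetric] show "L2_of (schwartz_fun \<psi>) = \<psi>"
    unfolding eq Quotient3_abs_rep[OF Quotient3_L2] .
qed

lemma schwartz_differentiable: "schwartz f \<Longrightarrow> f differentiable at x"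
  using smooth_differentiable_at[of f "[]"] by (simp add: schwartz_def)

section \<open>Skew-adjointness and commutator of the Clifford operators\<close>

lemma clifford_axis:
  "clifford (axis (Inl i) 1) \<psi> = clifford_s i \<psi>"
  "clifford (axis (Inr i) 1) \<psi> = clifford_t i \<psi>"
  by (simp_all add: clifford_def axis_def if_distrib[of "\<lambda>r. r *\<^sub>R _"] cong: if_cong)

text \<open>Multiplication by a purely imaginary function is skew-adjoint. The scalar
  \<open>c\<close> extends the identity to the whole Hermitian product, of which the real inner
  product sees only the real part.\<close>

lemma inner_clifford_s:
  assumes "\<psi> \<in> schwartz_space" "\<theta> \<in> schwartz_space"
  shows "clifford_s i \<psi> \<bullet> c *\<^sub>C \<theta> = - (\<psi> \<bullet> c *\<^sub>C clifford_s i \<theta>)"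
proof -
  define f g where "f = schwartz_fun \<psi>" and "g = schwartz_fun \<theta>"
  have s: "schwartz f" "schwartz g" and \<psi>: "\<psi> = L2_of f" and \<theta>: "\<theta> = L2_of g"
    using assms by (simp_all add: f_def g_def schwartz_schwartz_fun L2_of_schwartz_fun)
  note sq = schwartz_square_integrable[OF s(1)] schwartz_square_integrable[OF s(2)]
  have "(\<i> * complex_of_real (x $ i) * f x) \<bullet> (c * g x)
      = - (f x \<bullet> (c * (\<i> * complex_of_real (x $ i) * g x)))" for x
    by (simp add: inner_complex_def algebra_simps)
  then show ?thesis
    unfolding clifford_s_def f_def[symmetric] g_def[symmetric] unfolding \<psi> \<theta>
    by (simp add: scaleC_L2_of inner_L2_of sq square_integrable_scale)
qed

text \<open>Integration by parts; the constant \<open>c\<close> commutes with the partial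
  derivative.\<close>

lemma inner_clifford_t:
  assumes "\<psi> \<in> schwartz_space" "\<theta> \<in> schwartz_space"
  shows "clifford_t i \<psi> \<bullet> c *\<^sub>C \<theta> = - (\<psi> \<bullet> c *\<^sub>C clifford_t i \<theta>)"
proof -
  define f g where "f = schwartz_fun \<psi>" and "g = schwartz_fun \<theta>"
  have s: "schwartz f" "schwartz g" and \<psi>: "\<psi> = L2_of f" and \<theta>: "\<theta> = L2_of g"
    using assms by (simp_all add: f_def g_def schwartz_schwartz_fun L2_of_schwartz_fun)
  note sq = schwartz_square_integrable[OF s(1)] schwartz_square_integrable[OF s(2)]
  let ?d = "dir_deriv (axis i 1)"
  have D: "((\<lambda>x. c * g x) has_derivative (\<lambda>h. c * frechet_derivative g (at x) h)) (at x)" for x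
    using schwartz_differentiable[OF s(2)]
    by (intro has_derivative_mult_right) (simp add: frechet_derivative_works)
  have d: "?d (\<lambda>x. c * g x) = (\<lambda>x. c * ?d g x)"
    using dir_deriv_eqI[OF D] by (auto simp: dir_deriv_def)
  have "(\<integral>x. ?d f x \<bullet> (c * g x) \<partial>lborel) = - (\<integral>x. f x \<bullet> ?d (\<lambda>x. c * g x) x \<partial>lborel)"
  proof (rule integral_by_parts_dir_deriv)
    show "(\<lambda>x. c * g x) differentiable at x" for x
      using D by (auto simp: differentiable_def)
  qed (use sq in \<open>auto simp: d intro!: continuous_on_mult continuous_on_const schwartz_dir_deriv_continuous
    schwartz_differentiable s square_integrable_inner square_integrable_scale\<close>)
  then show ?thesis
    unfolding clifford_t_def f_def[symmetric] g_def[symmetric] unfolding \<psi> \<theta>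
    by (simp add: d scaleC_L2_of inner_L2_of sq square_integrable_scale)
qed

text \<open>For the representative f, the pairing is minus the integral of x^i times half the i-th
  derivative of |f|^2. By parts, this is half the squared norm of \<open>\<psi>\<close>.\<close>

lemma schwartz_eq_0_if_clifford_orthogonal:
  assumes \<psi>: "\<psi> \<in> schwartz_space" and orth: "\<i> *\<^sub>C clifford_s i \<psi> \<bullet> clifford_t i \<psi> = 0"
  shows "\<psi> = 0"
proof -
  define f where "f = schwartz_fun \<psi>"
  have s: "schwartz f" and \<psi>f: "\<psi> = L2_of f"
    using assms by (simp_all add: f_def schwartz_schwartz_fun L2_of_schwartz_fun)
  note sq = schwartz_square_integrable[OF s]
  let ?d = "dir_deriv (axis i 1)"
  let ?xf = "\<lambda>x. x $ i *\<^sub>R f x"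
  have sqx: "square_integrable ?xf"
    using square_integrable_scale[OF sq(2)[of i], of "- \<i>"]
    by (simp add: scaleR_conv_of_real mult.assoc[symmetric])
  have "\<i> * (\<i> * complex_of_real (x $ i) * f x) = - ?xf x" for x
    by (simp add: scaleR_conv_of_real mult.assoc[symmetric])
  then have "\<i> *\<^sub>C clifford_s i \<psi> \<bullet> clifford_t i \<psi> = - (\<integral>x. ?xf x \<bullet> ?d f x \<partial>lborel)"
    unfolding clifford_s_def clifford_t_def f_def[symmetric]
    by (simp add: scaleC_L2_of inner_L2_of sq sqx square_integrable_uminus)
  with orth have 0: "(\<integral>x. ?xf x \<bullet> ?d f x \<partial>lborel) = 0" by simp
  have D: "(?xf has_derivative (\<lambda>h. x $ i *\<^sub>R frechet_derivative f (at x) h + h $ i *\<^sub>R f x)) (at x)" for x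
    using schwartz_differentiable[OF s]
    by (intro has_derivative_scaleR bounded_linear_imp_has_derivative bounded_linear_vec_nth)
      (simp add: frechet_derivative_works)
  have d: "?d ?xf = (\<lambda>x. x $ i *\<^sub>R ?d f x + f x)"
    using dir_deriv_eqI[OF D] by (auto simp: dir_deriv_def)
  \<comment> \<open>The factor x^i is moved from the derivative to \<open>f\<close>; both summands
    then are products of square-integrable functions.\<close>
  have swap: "(x $ i *\<^sub>R ?d f x + f x) \<bullet> f x = ?xf x \<bullet> ?d f x + f x \<bullet> f x" for x
    by (simp add: inner_add_left inner_add_right inner_commute)
  have i1: "integrable lborel (\<lambda>x. ?xf x \<bullet> ?d f x)" and i2: "integrable lborel (\<lambda>x. f x \<bullet> f x)"
    by (intro square_integrable_inner sq sqx)+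
  have "(\<integral>x. ?d ?xf x \<bullet> f x \<partial>lborel) = - (\<integral>x. ?xf x \<bullet> ?d f x \<partial>lborel)"
  proof (rule integral_by_parts_dir_deriv)
    show "?xf differentiable at x" for x
      using D by (auto simp: differentiable_def)
    show "continuous_on UNIV (?d ?xf)"
      unfolding d
      by (intro continuous_intros schwartz_continuous schwartz_dir_deriv_continuous s)
    show "integrable lborel (\<lambda>x. ?xf x \<bullet> f x)"
      by (intro square_integrable_inner sq sqx)
    show "integrable lborel (\<lambda>x. ?d ?xf x \<bullet> f x)"
      unfolding d swap by (intro Bochner_Integration.integrable_add i1 i2)
  qed (intro i1 schwartz_dir_deriv_continuous schwartz_differentiable s)+
  then have "(\<integral>x. ?xf x \<bullet> ?d f x + f x \<bullet> f x \<partial>lborel) = 0"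
    unfolding d swap 0 by simp
  then have "\<psi> \<bullet> \<psi> = 0"
    unfolding Bochner_Integration.integral_add[OF i1 i2] 0 by (simp add: \<psi>f inner_L2_of sq)
  then show ?thesis by simp
qed

section \<open>Killing spinors on the flat space\<close>

lemma smooth_const: "smooth (\<lambda>x. c)"
proof -
  \<comment> \<open>Differentiation turns the constant \<open>c\<close> into 0, so the induction
    leaves \<open>c\<close> arbitrary.\<close>
  have "\<exists>d. fold dir_deriv vs (\<lambda>x::'a. c) = (\<lambda>x. d)" for vs
  proof (induction vs arbitrary: c)
    case (Cons v vs)
    have "dir_deriv v (\<lambda>x::'a. c) = (\<lambda>x. 0)"
      by (auto simp: dir_deriv_def)
    with Cons.IH[of 0] show ?case by simp
  qed auto
  then show ?thesis
    unfolding smooth_def by (metis differentiable_on_const)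
qed

text \<open>The Killing equation is evaluated on the constant vector field \<open>v\<close>.\<close>

lemma dir_deriv_killing_spinor:
  assumes "symplectic_killing_spinor_field lam \<phi>"
  shows "dir_deriv v \<phi> m = lam *\<^sub>C clifford v (\<phi> m)"
  using assms smooth_const[of v]
  by (auto simp: symplectic_killing_spinor_field_def spinor_derivative_def)

lemma killing_spinor_number_eq_0:
  fixes \<phi> :: "real ^ ('l + 'l) \<Rightarrow> (real ^ 'l::finite) L2"
  assumes killing: "symplectic_killing_spinor_field lam \<phi>"
  shows "lam = 0"
proof (rule ccontr)
  assume lam: "lam \<noteq> 0"
  have smooth: "smooth \<phi>" and schwartz: "\<And>m. \<phi> m \<in> schwartz_space" and nz: "\<phi> \<noteq> (\<lambda>m. 0)"
    using killing by (auto simp: symplectic_killing_spinor_field_def symplectic_spinor_field_def)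
  \<comment> \<open>Any index will do; one exists because types are nonempty, which is the condition
    l \<ge> 1.\<close>
  define i :: 'l where "i = undefined"
  define u v :: "real ^ ('l + 'l)" where "u = axis (Inl i) 1" and "v = axis (Inr i) 1"
  let ?A = "clifford_s i" and ?D = "clifford_t i"
  have du: "dir_deriv u \<phi> p = lam *\<^sub>C ?A (\<phi> p)" and dv: "dir_deriv v \<phi> p = lam *\<^sub>C ?D (\<phi> p)" for p
    by (simp_all add: u_def v_def dir_deriv_killing_spinor[OF killing] clifford_axis)
  have d0: "\<phi> differentiable at p" for p
    using smooth_differentiable_at[OF smooth, of "[]"] by simp
  have d1: "dir_deriv w \<phi> differentiable at p" for w p
    using smooth_differentiable_at[OF smooth, of "[w]"] by simp
  \<comment> \<open>As \<open>g\<close> and \<open>h\<close> do not depend on \<open>p\<close>, the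
    hypothesis can be differentiated in \<open>p\<close>. Only \<open>\<phi>\<close> is
    differentiated on its right-hand side, so no unbounded operator has to pass through a
    limit.\<close>
  have second: "dir_deriv b (dir_deriv a \<phi>) m \<bullet> g = dir_deriv b \<phi> m \<bullet> h"
    if "\<And>p. dir_deriv a \<phi> p \<bullet> g = \<phi> p \<bullet> h" for a b m g h
  proof -
    have "dir_deriv b (dir_deriv a \<phi>) m \<bullet> g = dir_deriv b (\<lambda>p. dir_deriv a \<phi> p \<bullet> g) m"
      using dir_deriv_inner_left(2)[OF d1] by simp
    also have "\<dots> = dir_deriv b \<phi> m \<bullet> h"
      using dir_deriv_inner_left(2)[OF d0] by (simp add: that)
    finally show ?thesis .
  qed
  have "\<phi> m = 0" for m
  proof -
    \<comment> \<open>The factor \<open>c\<close> absorbs \<open>lam\<close> and turns the real inner product into the part of the Hermitian one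
      that contains \<open>\<parallel>\<phi> m\<parallel>\<^sup>2\<close>.\<close>
    define c where "c = \<i> / (cnj lam)\<^sup>2"
    define g where "g = c *\<^sub>C \<phi> m"
    have c: "cnj lam * (cnj lam * c) = \<i>"
      using lam by (simp add: c_def power2_eq_square)
    have "dir_deriv u \<phi> p \<bullet> g = \<phi> p \<bullet> - ((cnj lam * c) *\<^sub>C ?A (\<phi> m))" for p
      using inner_clifford_s[OF schwartz schwartz]
      by (simp add: du g_def inner_scaleC_left scaleC_scaleC)
    from second[OF this] have uv: "dir_deriv v (dir_deriv u \<phi>) m \<bullet> g = - (?D (\<phi> m) \<bullet> \<i> *\<^sub>C ?A (\<phi> m))"
      by (simp add: dv inner_scaleC_left scaleC_scaleC c)
    have "dir_deriv v \<phi> p \<bullet> g = \<phi> p \<bullet> - ((cnj lam * c) *\<^sub>C ?D (\<phi> m))" for p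
      using inner_clifford_t[OF schwartz schwartz]
      by (simp add: dv g_def inner_scaleC_left scaleC_scaleC)
    from second[OF this] have "dir_deriv u (dir_deriv v \<phi>) m \<bullet> g = - (?A (\<phi> m) \<bullet> \<i> *\<^sub>C ?D (\<phi> m))"
      by (simp add: du inner_scaleC_left scaleC_scaleC c)
    also have "\<dots> = \<i> *\<^sub>C ?A (\<phi> m) \<bullet> ?D (\<phi> m)"
      by (simp add: inner_scaleC_left scaleC_minus_left)
    \<comment> \<open>The two mixed derivatives have opposite pairings with \<open>g\<close>; as
      they coincide, the pairing is 0.\<close>
    finally have "\<i> *\<^sub>C ?A (\<phi> m) \<bullet> ?D (\<phi> m) = 0"
      using uv dir_deriv_commute[OF smooth, of v u m] by (simp add: inner_commute)
    then show ?thesis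
      by (rule schwartz_eq_0_if_clifford_orthogonal[OF schwartz])
  qed
  with nz show False by auto
qed

theorem mainTheorem4:
  shows "(\<forall>lam \<in> symplectic_killing_spinor_numbers TYPE('l::finite). lam = 0) \<and>
    (\<forall>lam (\<phi> :: real ^ ('l + 'l) \<Rightarrow> (real ^ 'l) L2). symplectic_killing_spinor_field lam \<phi> \<longrightarrow>
      (\<exists>\<psi> :: (real ^ 'l) L2. \<forall>m. \<phi> m = \<psi>))"
proof (intro conjI ballI allI impI)
  fix lam
  assume "lam \<in> symplectic_killing_spinor_numbers TYPE('l)"
  then show "lam = 0"
    using killing_spinor_number_eq_0 by (auto simp: symplectic_killing_spinor_numbers_def)
next
  fix lam and \<phi> :: "real ^ ('l + 'l) \<Rightarrow> (real ^ 'l) L2"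
  assume killing: "symplectic_killing_spinor_field lam \<phi>"
  \<comment> \<open>Once the Killing number is 0, the right-hand side of the Killing equation
    vanishes in every direction.\<close>
  then have "dir_deriv v \<phi> m = 0" for v m
    using killing_spinor_number_eq_0[OF killing]
    by (simp add: dir_deriv_killing_spinor scaleC_zero_left)
  then have 0: "frechet_derivative \<phi> (at m) = (\<lambda>h. 0)" for m
    by (auto simp: dir_deriv_def)
  have "\<phi> differentiable at m" for m
    using killing smooth_differentiable_at[of \<phi> "[]"]
    by (simp add: symplectic_killing_spinor_field_def symplectic_spinor_field_def)
  then have "(\<phi> has_derivative (\<lambda>h. 0)) (at m)" for m
    by (simp add: frechet_derivative_works 0)
  then have "\<phi> m = \<phi> 0" for m
    by (intro has_derivative_zero_unique[OF convex_UNIV, of \<phi>]) auto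
  then show "\<exists>\<psi>. \<forall>m. \<phi> m = \<psi>" by blast
qed

end
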